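(* Let $k\ge 1$, let $\mathcal{G}_1,\ldots,\mathcal{G}_k$ be ordered graphs, each containing at least one edge, let $\boldsymbol{\lambda}=(\lambda_1,\ldots,\lambda_k)\in(0,\infty)^k$, and put $R=\overline{\mathrm{R}}(\mathcal{G}_1,\ldots,\mathcal{G}_k)$, $h_i=v(\mathcal{G}_i)$ and $h_*=\min_{i\in[k]}h_i$. Let $R\le t\le n$ be integers and let $J_t=\{i\in[k]:h_i\le t\}$. Then every coloring $\chi:E(\mathcal{K}_n)\to[k]$ satisfies $$\sum_{i\in J_t}\lambda_iN_i(\chi;\mathcal{G}_i)\binom{n-h_i}{t-h_i}\ \ge\ \overline{\mathrm{M}}_{\boldsymbol{\lambda}}(t;\mathcal{G}_1,\ldots,\mathcal{G}_k)\binom{n}{t},$$ or equivalently $$\sum_{i\in J_t}\lambda_iN_i(\chi;\mathcal{G}_i)\frac{\binom{t}{h_i}}{\binom{n}{h_i}}\ \ge\ \overline{\mathrm{M}}_{\boldsymbol{\lambda}}(t;\mathcal{G}_1,\ldots,\mathcal{G}_k).$$ Consequently, $$\overline{\mathrm{M}}_{\boldsymbol{\lambda}}(n;\mathcal{G}_1,\ldots,\mathcal{G}_k)\ \ge\ \overline{\mathrm{M}}_{\boldsymbol{\lambda}}(t;\mathcal{G}_1,\ldots,\mathcal{G}_k)\,\frac{\binom{n}{h_*}}{\binom{t}{h_*}}.$$ Moreover, for every coloring $\chi:E(\mathcal{K}_n)\to[k]$ there is an index $i\in J_t$ for which $$N_i(\chi;\mathcal{G}_i)\ \ge\ \frac{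\overline{\mathrm{M}}_{\boldsymbol{\lambda}}(t;\mathcal{G}_1,\ldots,\mathcal{G}_k)}{|J_t|\,\lambda_i}\cdot\frac{\binom{n}{h_i}}{\binom{t}{h_i}}.$$
   Context: An ordered graph is a pair $\mathcal{G}=(G,<_{\mathcal{G}})$ where $G$ is a finite graph and $<_{\mathcal{G}}$ is a linear order on $V(G)$; $v(\mathcal{G})$ is its number of vertices. $[k]=\{1,\ldots,k\}$. $\mathcal{K}_n$ is the complete graph on $[n]$ with the natural order. An order-preserving copy of an ordered graph $\mathcal{H}$ in $\mathcal{G}$ is an injective map $V(\mathcal{H})\to V(\mathcal{G})$ that preserves the vertex order and maps every edge of $\mathcal{H}$ to an edge of $\mathcal{G}$; an $h$-element vertex set of an ordered host supports at most one copy of a fixed $h$-vertex ordered graph, and copies are counted by their vertex sets. For a coloring $\chi:E(\mathcal{K}_n)\to[k]$, $N_i(\chi;\mathcal{G}_i)$ is the number of order-preserving copies of $\mathcal{G}_i$ in $\mathcal{K}_n$ all of whose edges have color $i$. The ordered Ramsey number $\overline{\mathrm{R}}(\mathcal{G}_1,\ldots,\mathcal{G}_k)$ is the least $N$ such that every $k$-edge-coloring of $\mathcal{K}_N$ contains an order-preserving copy of $\mathcal{G}_i$ in color $i$ for some $i\in[k]$. The weighted ordered multiplicity function is $$\overline{\mathrm{M}}_{\boldsymbol{\lambda}}(n;\mathcal{G}_1,\ldots,\mathcal{G}_k)=\min_{\chi:E(\mathcal{K}_n)\to[k]}\sum_{i=1}^{k}\lambda_iN_i(\chi;\mathcal{G}_i).$$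 *)

theory Defs
  imports Complex_Main "HOL-Library.Ramsey"
begin

record 'a ordered_graph =
  verts :: "'a set"
  edges :: "'a set set"
  vord :: "('a \<times> 'a) set"

text \<open>The relation \<^term>\<open>vord G\<close> is the strict order; it is required to live on the vertices
  because \<^const>\<open>strict_linear_order_on\<close> does not confine a relation to its carrier.\<close>

definition ordered_graph :: "'a ordered_graph \<Rightarrow> bool" where
  "ordered_graph G \<longleftrightarrow>
     finite (verts G) \<and> edges G \<subseteq> nsets (verts G) 2 \<and>
     vord G \<subseteq> verts G \<times> verts G \<and> strict_linear_order_on (verts G) (vord G)"

abbreviation num_verts :: "'a ordered_graph \<Rightarrow> nat" where
  "num_verts G \<equiv> card (verts G)"

definition complete_ordered :: "nat \<Rightarrow> nat ordered_graph" where
  "complete_ordered n =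
     \<lparr>verts = {1..n}, edges = nsets {1..n} 2,
      vord = {(a, b). a \<in> {1..n} \<and> b \<in> {1..n} \<and> a < b}\<rparr>"

definition is_copy :: "'a ordered_graph \<Rightarrow> 'b ordered_graph \<Rightarrow> ('a \<Rightarrow> 'b) \<Rightarrow> bool" where
  "is_copy H G f \<longleftrightarrow>
     f \<in> verts H \<rightarrow> verts G \<and> inj_on f (verts H) \<and>
     (\<forall>(u, v) \<in> vord H. (f u, f v) \<in> vord G) \<and>
     (\<forall>e \<in> edges H. f ` e \<in> edges G)"

definition colorings :: "nat \<Rightarrow> nat \<Rightarrow> (nat set \<Rightarrow> nat) set" where
  "colorings k n = edges (complete_ordered n) \<rightarrow>\<^sub>E {1..k}"

definition is_mono_copy ::
    "nat \<Rightarrow> (nat set \<Rightarrow> nat) \<Rightarrow> nat \<Rightarrow> 'a ordered_graph \<Rightarrow> ('a \<Rightarrow> nat) \<Rightarrow> bool" where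
  "is_mono_copy n \<chi> i H f \<longleftrightarrow>
     is_copy H (complete_ordered n) f \<and> (\<forall>e \<in> edges H. \<chi> (f ` e) = i)"

text \<open>Copies are counted by their vertex sets, so two maps that differ only outside
  \<^term>\<open>verts H\<close> count once.\<close>

definition num_mono_copies :: "nat \<Rightarrow> (nat set \<Rightarrow> nat) \<Rightarrow> nat \<Rightarrow> 'a ordered_graph \<Rightarrow> nat" where
  "num_mono_copies n \<chi> i H = card {f ` verts H | f. is_mono_copy n \<chi> i H f}"

text \<open>By Ramsey's theorem such an \<open>N\<close> exists whenever \<open>k \<ge> 1\<close> and all \<open>G i\<close> are ordered graphs.\<close>

definition ordered_ramsey :: "nat \<Rightarrow> (nat \<Rightarrow> 'a ordered_graph) \<Rightarrow> nat" where
  "ordered_ramsey k G =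
     (LEAST N. \<forall>\<chi> \<in> colorings k N. \<exists>i \<in> {1..k}. \<exists>f. is_mono_copy N \<chi> i (G i) f)"

text \<open>For \<open>k \<ge> 1\<close> the set of colorings is finite and nonempty, so the minimum is attained.\<close>

definition ordered_multiplicity ::
    "nat \<Rightarrow> (nat \<Rightarrow> real) \<Rightarrow> nat \<Rightarrow> (nat \<Rightarrow> 'a ordered_graph) \<Rightarrow> real" where
  "ordered_multiplicity k w n G =
     Min ((\<lambda>\<chi>. \<Sum>i = 1..k. w i * real (num_mono_copies n \<chi> i (G i))) ` colorings k n)"

end

theory Submission
  imports Defs
begin

text \<open>
  Restrict a coloring of \<open>K\<^sub>n\<close> to each of the \<open>n choose t\<close> vertex sets of size \<open>t\<close>.  Each restriction
  has weighted count at least the multiplicity at \<open>t\<close>, and a copy on \<open>h\<close> vertices is seen by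
  exactly \<open>(n - h) choose (t - h)\<close> of these sets, so double counting gives the first
  inequality.  The others follow by binomial identities; Ramsey's theorem enters only to ensure
  that \<open>J\<close> is nonempty, so that the final averaging is possible.
\<close>

section \<open>Supersets and increasing enumerations of finite sets\<close>

text \<open>Removing \<open>S\<close> is a bijection onto the subsets of \<open>A - S\<close> of
  size \<open>t - card S\<close>. The bound \<open>card S \<le> t\<close> guards the truncated
  subtraction: for larger \<open>S\<close> the right side would be 1 and the left side 0.\<close>

lemma card_supersets:
  assumes "finite A" "S \<subseteq> A" "card S \<le> t"
  shows "card {T. T \<subseteq> A \<and> S \<subseteq> T \<and> card T = t} = (card A - card S) choose (t - card S)"
proof -
  have fS: "finite S"
    using assms finite_subset by blast
  have "bij_betw (\<lambda>U. U \<union> S) {U. U \<subseteq> A - S \<and> card U = t - card S}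
          {T. T \<subseteq> A \<and> S \<subseteq> T \<and> card T = t}"
  proof (rule bij_betw_byWitness[where f' = "\<lambda>T. T - S"])
    show "(\<lambda>U. U \<union> S) ` {U. U \<subseteq> A - S \<and> card U = t - card S}
            \<subseteq> {T. T \<subseteq> A \<and> S \<subseteq> T \<and> card T = t}"
    proof clarify
      fix U assume U: "U \<subseteq> A - S" "card U = t - card S"
      then have "finite U" "U \<inter> S = {}"
        using assms(1) by (auto intro: finite_subset)
      then have "card (U \<union> S) = t"
        using U(2) fS assms(3) by (simp add: card_Un_disjoint)
      then show "U \<union> S \<subseteq> A \<and> S \<subseteq> U \<union> S \<and> card (U \<union> S) = t"
        using U(1) assms(2) by auto
    qed
    show "(\<lambda>T. T - S) ` {T. T \<subseteq> A \<and> S \<subseteq> T \<and> card T = t}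
            \<subseteq> {U. U \<subseteq> A - S \<and> card U = t - card S}"
      using fS by (auto simp: card_Diff_subset)
  qed auto
  then have "card {T. T \<subseteq> A \<and> S \<subseteq> T \<and> card T = t}
      = card {U. U \<subseteq> A - S \<and> card U = t - card S}"
    by (rule bij_betw_same_card[symmetric])
  then show ?thesis
    using assms fS by (simp add: n_subsets card_Diff_subset)
qed

text \<open>The enumeration of \<open>T\<close> indexed from 0 is shifted by one, so that its domain
  is the vertex set of \<open>complete_ordered (card T)\<close>.\<close>

lemma strict_mono_enumeration:
  fixes T :: "nat set"
  assumes "finite T"
  obtains \<phi> where "strict_mono_on {1..card T} \<phi>" "\<phi> ` {1..card T} = T"
proof -
  obtain e where e: "bij_betw e {..<card T} T" "strict_mono_on {..<card T} e"
    using ex_bij_betw_strict_mono_card[OF assms] .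
  have "(\<lambda>x. x - 1) ` {1..card T} = {..<card T}"
  proof
    show "{..<card T} \<subseteq> (\<lambda>x. x - 1) ` {1..card T}"
    proof
      fix x assume "x \<in> {..<card T}"
      then show "x \<in> (\<lambda>x. x - 1) ` {1..card T}"
        by (intro image_eqI[of _ _ "Suc x"]) auto
    qed
  qed auto
  then have "(\<lambda>x. e (x - 1)) ` {1..card T} = T"
    using e(1) unfolding bij_betw_def by (metis image_image)
  moreover have "strict_mono_on {1..card T} (\<lambda>x. e (x - 1))"
    by (rule strict_mono_onI, rule strict_mono_onD[OF e(2)]) auto
  ultimately show thesis
    using that by blast
qed

text \<open>Each vertex of \<open>H\<close> goes to the element of \<open>T\<close> that has the
  same position in increasing order.\<close>

lemma ordered_graph_order_embedding:
  fixes T :: "nat set"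
  assumes "ordered_graph H" "finite T" "card T = num_verts H"
  obtains f where "f \<in> verts H \<rightarrow> T" "inj_on f (verts H)" "\<forall>(u, v) \<in> vord H. f u < f v"
proof -
  obtain \<phi> where \<phi>: "strict_mono_on {1..card T} \<phi>" "\<phi> ` {1..card T} = T"
    using strict_mono_enumeration[OF assms(2)] .
  have fin: "finite (verts H)" and sub: "vord H \<subseteq> verts H \<times> verts H"
    and tr: "trans (vord H)" and irr: "irrefl (vord H)" and tot: "total_on (verts H) (vord H)"
    using assms(1) by (auto simp: ordered_graph_def strict_linear_order_on_def)
  \<comment> \<open>The position of \<open>v\<close> in the order of \<open>H\<close>, counted from
    1 to match the domain of \<open>\<phi>\<close>.\<close>
  define rank where "rank v = Suc (card {u. (u, v) \<in> vord H})" for v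
  have fb: "finite {u. (u, v) \<in> vord H}" for v
    by (rule finite_subset[OF _ fin]) (use sub in auto)
  have mono: "rank u < rank v" if "(u, v) \<in> vord H" for u v
  proof -
    \<comment> \<open>Transitivity gives the inclusion; by irreflexivity \<open>u\<close> itself
      lies only in the larger set.\<close>
    have "{x. (x, u) \<in> vord H} \<subset> {x. (x, v) \<in> vord H}"
      using that tr irr unfolding trans_def irrefl_def by blast
    then show ?thesis
      unfolding rank_def using psubset_card_mono[OF fb] by simp
  qed
  have bound: "rank v \<in> {1..card T}" if "v \<in> verts H" for v
  proof -
    \<comment> \<open>By irreflexivity \<open>v\<close> is not among its own predecessors, so the
      \<open>Suc\<close> in \<open>rank\<close> does not exceed \<open>card T\<close>.\<close>
    have "{x. (x, v) \<in> vord H} \<subset> verts H"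
      using that sub irr unfolding irrefl_def by blast
    then show ?thesis
      unfolding rank_def assms(3) using psubset_card_mono[OF fin] by (simp add: Suc_le_eq)
  qed
  have less: "\<phi> (rank u) < \<phi> (rank v)" if "(u, v) \<in> vord H" for u v
    using strict_mono_onD[OF \<phi>(1) bound bound mono[OF that]] that sub by blast
  show thesis
  proof (rule that)
    show "(\<lambda>v. \<phi> (rank v)) \<in> verts H \<rightarrow> T"
      using bound \<phi>(2) by blast
    show "\<forall>(u, v) \<in> vord H. \<phi> (rank u) < \<phi> (rank v)"
      using less by blast
    \<comment> \<open>Totality makes distinct vertices comparable, and comparable vertices have
      distinct images.\<close>
    show "inj_on (\<lambda>v. \<phi> (rank v)) (verts H)"
      using less tot unfolding inj_on_def total_on_def by (metis less_irrefl)
  qed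
qed

section \<open>Colorings and the attained minimum\<close>

lemma is_copy_complete_iff:
  "is_copy H (complete_ordered n) f \<longleftrightarrow>
     f \<in> verts H \<rightarrow> {1..n} \<and> inj_on f (verts H) \<and>
     (\<forall>(u, v) \<in> vord H. f u \<in> {1..n} \<and> f v \<in> {1..n} \<and> f u < f v) \<and>
     (\<forall>e \<in> edges H. f ` e \<in> nsets {1..n} 2)"
  by (simp add: is_copy_def complete_ordered_def)

lemma colorings_eq: "colorings k n = nsets {1..n} 2 \<rightarrow>\<^sub>E {1..k}"
  by (simp add: colorings_def complete_ordered_def)

lemma finite_colorings: "finite (colorings k n)"
  unfolding colorings_eq by (intro finite_PiE finite_imp_finite_nsets) auto

lemma colorings_nonempty: "k \<ge> 1 \<Longrightarrow> colorings k n \<noteq> {}"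
  unfolding colorings_eq by (auto simp: PiE_eq_empty_iff)

lemma ordered_multiplicity_le:
  assumes "\<chi> \<in> colorings k n"
  shows "ordered_multiplicity k w n G \<le> (\<Sum>i = 1..k. w i * real (num_mono_copies n \<chi> i (G i)))"
  unfolding ordered_multiplicity_def using assms by (intro Min_le finite_imageI finite_colorings) auto

lemma ordered_multiplicity_attained:
  assumes "k \<ge> 1"
  obtains \<chi> where "\<chi> \<in> colorings k n"
    "ordered_multiplicity k w n G = (\<Sum>i = 1..k. w i * real (num_mono_copies n \<chi> i (G i)))"
proof -
  have "ordered_multiplicity k w n G
      \<in> (\<lambda>\<chi>. \<Sum>i = 1..k. w i * real (num_mono_copies n \<chi> i (G i))) ` colorings k n"
    unfolding ordered_multiplicity_def
    using assms by (intro Min_in finite_imageI finite_colorings) (simp add: colorings_nonempty)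
  then show thesis
    using that by blast
qed

section \<open>Monochromatic copies as vertex sets\<close>

text \<open>Naming the set counted by \<open>num_mono_copies\<close> makes it possible to ask which
  copies lie inside a given vertex set.\<close>

definition mono_copy_sets :: "nat \<Rightarrow> (nat set \<Rightarrow> nat) \<Rightarrow> nat \<Rightarrow> 'a ordered_graph \<Rightarrow> nat set set" where
  "mono_copy_sets n \<chi> i H = {f ` verts H | f. is_mono_copy n \<chi> i H f}"

lemma num_mono_copies_eq: "num_mono_copies n \<chi> i H = card (mono_copy_sets n \<chi> i H)"
  by (simp add: num_mono_copies_def mono_copy_sets_def)

lemma mono_copy_sets_subset: "mono_copy_sets n \<chi> i H \<subseteq> {S. S \<subseteq> {1..n} \<and> card S = num_verts H}"
  by (auto simp: mono_copy_sets_def is_mono_copy_def is_copy_complete_iff card_image Pi_def)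

lemma finite_mono_copy_sets: "finite (mono_copy_sets n \<chi> i H)"
  by (rule finite_subset[OF mono_copy_sets_subset]) simp

text \<open>There is no room for an injective image of \<open>verts H\<close>. This is what confines
  the weighted sum at \<open>t\<close> to the colors in \<open>J\<close>.\<close>

lemma num_mono_copies_eq_0: "n < num_verts H \<Longrightarrow> num_mono_copies n \<chi> i H = 0"
proof -
  assume *: "n < num_verts H"
  have "{S. S \<subseteq> {1..n} \<and> card S = num_verts H} = {}"
    using * by (auto dest: card_mono[rotated])
  then have "mono_copy_sets n \<chi> i H = {}"
    using mono_copy_sets_subset[of n \<chi> i H] by blast
  then show ?thesis
    by (simp add: num_mono_copies_eq)
qed

section \<open>Restricting a coloring to a vertex subset\<close>

text \<open>With \<open>\<phi>\<close> the increasing enumeration of a \<open>t\<close>-set, this is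
  the coloring induced on that set, relabelled to live on \<open>{1..t}\<close>. The restricted
  abstraction keeps it extensional, as membership in \<open>colorings k t\<close> demands.\<close>

definition pullback_coloring :: "nat \<Rightarrow> (nat \<Rightarrow> nat) \<Rightarrow> (nat set \<Rightarrow> nat) \<Rightarrow> nat set \<Rightarrow> nat" where
  "pullback_coloring t \<phi> \<chi> = (\<lambda>e \<in> nsets {1..t} 2. \<chi> (\<phi> ` e))"

lemma pullback_coloring_in_colorings:
  assumes "\<chi> \<in> colorings k n" "inj_on \<phi> {1..t}" "\<phi> ` {1..t} \<subseteq> {1..n}"
  shows "pullback_coloring t \<phi> \<chi> \<in> colorings k t"
proof -
  have "(\<lambda>e. \<phi> ` e) \<in> nsets {1..t} 2 \<rightarrow> nsets {1..n} 2"
    using assms by (intro nsets_image_funcset) auto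
  then show ?thesis
    using assms(1) unfolding colorings_eq pullback_coloring_def by (auto simp: PiE_iff Pi_iff)
qed

lemma is_mono_copy_pullback:
  assumes "strict_mono_on {1..t} \<phi>" "\<phi> ` {1..t} \<subseteq> {1..n}"
    and f: "is_mono_copy t (pullback_coloring t \<phi> \<chi>) i H f"
  shows "is_mono_copy n \<chi> i H (\<phi> \<circ> f)"
proof -
  have inj: "inj_on \<phi> {1..t}"
    using assms(1) by (rule strict_mono_on_imp_inj_on)
  have im: "(\<lambda>e. \<phi> ` e) \<in> nsets {1..t} 2 \<rightarrow> nsets {1..n} 2"
    using assms inj by (intro nsets_image_funcset) auto
  have fV: "f \<in> verts H \<rightarrow> {1..t}" and fi: "inj_on f (verts H)"
    and fo: "\<And>u v. (u, v) \<in> vord H \<Longrightarrow> f u \<in> {1..t} \<and> f v \<in> {1..t} \<and> f u < f v"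
    and fe: "\<And>e. e \<in> edges H \<Longrightarrow> f ` e \<in> nsets {1..t} 2"
    and fc: "\<And>e. e \<in> edges H \<Longrightarrow> pullback_coloring t \<phi> \<chi> (f ` e) = i"
    using f by (auto simp: is_mono_copy_def is_copy_complete_iff)
  have "inj_on (\<phi> \<circ> f) (verts H)"
    using fi inj fV by (intro comp_inj_on inj_on_subset[OF inj]) auto
  moreover have "\<forall>(u, v) \<in> vord H. (\<phi> \<circ> f) u \<in> {1..n} \<and> (\<phi> \<circ> f) v \<in> {1..n} \<and> (\<phi> \<circ> f) u < (\<phi> \<circ> f) v"
  proof clarify
    fix u v assume "(u, v) \<in> vord H"
    then have uv: "f u \<in> {1..t}" "f v \<in> {1..t}" "f u < f v"
      using fo by auto
    then show "(\<phi> \<circ> f) u \<in> {1..n} \<and> (\<phi> \<circ> f) v \<in> {1..n} \<and> (\<phi> \<circ> f) u < (\<phi> \<circ> f) v"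
      using assms(2) strict_mono_onD[OF assms(1) uv] by (simp only: comp_apply image_subset_iff)
  qed
  moreover have "\<forall>e \<in> edges H. (\<phi> \<circ> f) ` e \<in> nsets {1..n} 2"
    unfolding image_comp[symmetric] using fe im by blast
  moreover have "\<forall>e \<in> edges H. \<chi> ((\<phi> \<circ> f) ` e) = i"
    unfolding image_comp[symmetric] using fe fc by (simp add: pullback_coloring_def)
  moreover have "\<phi> \<circ> f \<in> verts H \<rightarrow> {1..n}"
    using fV assms(2) by (auto simp: Pi_iff image_subset_iff)
  ultimately show ?thesis
    unfolding is_mono_copy_def is_copy_complete_iff by blast
qed

text \<open>Taking images under \<open>\<phi>\<close> is injective on subsets of
  \<open>{1..t}\<close> and turns copies for the pullback into copies for \<open>\<chi>\<close>
  inside \<open>T\<close>.\<close>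

lemma num_mono_copies_pullback_le:
  assumes "strict_mono_on {1..t} \<phi>" "\<phi> ` {1..t} = T" "T \<subseteq> {1..n}"
  shows "num_mono_copies t (pullback_coloring t \<phi> \<chi>) i H
    \<le> card {S \<in> mono_copy_sets n \<chi> i H. S \<subseteq> T}"
  unfolding num_mono_copies_eq
proof (rule card_inj_on_le)
  show "inj_on (\<lambda>S. \<phi> ` S) (mono_copy_sets t (pullback_coloring t \<phi> \<chi>) i H)"
    by (rule inj_on_subset[OF inj_on_image_Pow[OF strict_mono_on_imp_inj_on[OF assms(1)]]])
      (use mono_copy_sets_subset in blast)
  show "(\<lambda>S. \<phi> ` S) ` mono_copy_sets t (pullback_coloring t \<phi> \<chi>) i H
      \<subseteq> {S \<in> mono_copy_sets n \<chi> i H. S \<subseteq> T}"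
  proof (rule image_subsetI)
    fix S assume S: "S \<in> mono_copy_sets t (pullback_coloring t \<phi> \<chi>) i H"
    then obtain f where f: "S = f ` verts H" "is_mono_copy t (pullback_coloring t \<phi> \<chi>) i H f"
      by (auto simp: mono_copy_sets_def)
    then have "is_mono_copy n \<chi> i H (\<phi> \<circ> f)"
      using assms by (intro is_mono_copy_pullback) auto
    then have "(\<phi> \<circ> f) ` verts H \<in> mono_copy_sets n \<chi> i H"
      unfolding mono_copy_sets_def by blast
    then have "\<phi> ` S \<in> mono_copy_sets n \<chi> i H"
      by (simp only: f(1) image_comp)
    moreover have "\<phi> ` S \<subseteq> T"
      using S mono_copy_sets_subset assms(2) by blast
    ultimately show "\<phi> ` S \<in> {S \<in> mono_copy_sets n \<chi> i H. S \<subseteq> T}"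
      by simp
  qed
  show "finite {S \<in> mono_copy_sets n \<chi> i H. S \<subseteq> T}"
    using finite_mono_copy_sets[of n \<chi> i H] by simp
qed

section \<open>Double counting of copies and \<open>t\<close>-sets\<close>

text \<open>Both sides count pairs of a copy \<open>S\<close> and a \<open>t\<close>-set
  \<open>T\<close> containing it; summing over \<open>S\<close> first gives the right side, since
  all copies have equally many such supersets.\<close>

lemma sum_card_mono_copy_sets_within:
  assumes "num_verts H \<le> t"
  shows "(\<Sum>T | T \<subseteq> {1..n} \<and> card T = t. card {S \<in> mono_copy_sets n \<chi> i H. S \<subseteq> T})
    = num_mono_copies n \<chi> i H * ((n - num_verts H) choose (t - num_verts H))"
proof -
  let ?F = "{T. T \<subseteq> {1..n} \<and> card T = t}"
  have "(\<Sum>T\<in>?F. card {S \<in> mono_copy_sets n \<chi> i H. S \<subseteq> T})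
      = ((n - num_verts H) choose (t - num_verts H)) * card (mono_copy_sets n \<chi> i H)"
  proof (rule sum_multicount)
    show "finite ?F"
      by simp
    show "\<forall>S \<in> mono_copy_sets n \<chi> i H.
        card {T \<in> ?F. S \<subseteq> T} = (n - num_verts H) choose (t - num_verts H)"
    proof
      fix S assume "S \<in> mono_copy_sets n \<chi> i H"
      then have S: "S \<subseteq> {1..n}" "card S = num_verts H"
        using mono_copy_sets_subset by blast+
      have "{T \<in> ?F. S \<subseteq> T} = {T. T \<subseteq> {1..n} \<and> S \<subseteq> T \<and> card T = t}"
        by auto
      then show "card {T \<in> ?F. S \<subseteq> T} = (n - num_verts H) choose (t - num_verts H)"
        using card_supersets[of "{1..n}" S t] S assms by simp
    qed
  qed (rule finite_mono_copy_sets)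
  then show ?thesis
    by (simp add: num_mono_copies_eq mult.commute)
qed

lemma ordered_multiplicity_double_count:
  assumes w: "\<And>i. i \<in> {1..k} \<Longrightarrow> w i \<ge> 0" and \<chi>: "\<chi> \<in> colorings k n"
    and J: "J = {i \<in> {1..k}. num_verts (G i) \<le> t}"
  shows "ordered_multiplicity k w t G * real (n choose t)
    \<le> (\<Sum>i\<in>J. w i * real (num_mono_copies n \<chi> i (G i))
          * real ((n - num_verts (G i)) choose (t - num_verts (G i))))"
proof -
  let ?F = "{T. T \<subseteq> {1..n} \<and> card T = t}"
  let ?c = "\<lambda>T i. card {S \<in> mono_copy_sets n \<chi> i (G i). S \<subseteq> T}"
  \<comment> \<open>The local bound: the coloring induced on \<open>T\<close> competes in the
    minimum at \<open>t\<close>, and nonnegative weights let its copies be replaced by those of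
    \<open>\<chi>\<close> inside \<open>T\<close>.\<close>
  have each: "ordered_multiplicity k w t G \<le> (\<Sum>i\<in>J. w i * real (?c T i))" if "T \<in> ?F" for T
  proof -
    have T: "T \<subseteq> {1..n}" "card T = t" "finite T"
      using that by (auto intro: finite_subset)
    obtain \<phi> where \<phi>: "strict_mono_on {1..t} \<phi>" "\<phi> ` {1..t} = T"
      using strict_mono_enumeration[OF T(3)] T(2) by blast
    let ?\<psi> = "pullback_coloring t \<phi> \<chi>"
    have "?\<psi> \<in> colorings k t"
      using \<chi> \<phi> T by (intro pullback_coloring_in_colorings strict_mono_on_imp_inj_on) auto
    then have "ordered_multiplicity k w t G
        \<le> (\<Sum>i = 1..k. w i * real (num_mono_copies t ?\<psi> i (G i)))"
      by (rule ordered_multiplicity_le)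
    also have "\<dots> = (\<Sum>i\<in>J. w i * real (num_mono_copies t ?\<psi> i (G i)))"
      by (rule sum.mono_neutral_right) (use num_mono_copies_eq_0 in \<open>fastforce simp: J not_le\<close>)+
    also have "\<dots> \<le> (\<Sum>i\<in>J. w i * real (?c T i))"
      using w num_mono_copies_pullback_le[OF \<phi> T(1)] by (intro sum_mono mult_left_mono) (auto simp: J)
    finally show ?thesis .
  qed
  have "ordered_multiplicity k w t G * real (n choose t) = (\<Sum>T\<in>?F. ordered_multiplicity k w t G)"
    by (simp add: n_subsets)
  also have "\<dots> \<le> (\<Sum>T\<in>?F. \<Sum>i\<in>J. w i * real (?c T i))"
    by (rule sum_mono) (rule each)
  also have "\<dots> = (\<Sum>i\<in>J. w i * real (\<Sum>T\<in>?F. ?c T i))"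
    by (subst sum.swap) (simp add: sum_distrib_left)
  also have "\<dots> = (\<Sum>i\<in>J. w i * real (num_mono_copies n \<chi> i (G i))
          * real ((n - num_verts (G i)) choose (t - num_verts (G i))))"
  proof (rule sum.cong)
    fix i assume "i \<in> J"
    then have "num_verts (G i) \<le> t"
      by (simp add: J)
    then show "w i * real (\<Sum>T\<in>?F. ?c T i) = w i * real (num_mono_copies n \<chi> i (G i))
          * real ((n - num_verts (G i)) choose (t - num_verts (G i)))"
      by (simp only: sum_card_mono_copy_sets_within of_nat_mult mult.assoc)
  qed simp
  finally show ?thesis .
qed

section \<open>Finiteness of the ordered Ramsey number\<close>

text \<open>Gives the \<open>LEAST\<close> in \<open>ordered_ramsey\<close> a witness. Ramsey's
  theorem supplies a clique of some color \<open>i\<close> with as many vertices as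
  \<open>G i\<close>, and every ordered graph embeds in increasing order into a clique of its own
  size.\<close>

lemma ordered_ramsey_exists:
  assumes G: "\<And>i. i \<in> {1..k} \<Longrightarrow> ordered_graph (G i)"
  obtains N where "\<forall>\<chi> \<in> colorings k N. \<exists>i \<in> {1..k}. \<exists>f. is_mono_copy N \<chi> i (G i) f"
proof -
  let ?qs = "map (\<lambda>i. num_verts (G (Suc i))) [0..<k]"
  obtain N :: nat where N: "partn_lst {..<N} ?qs 2"
    using ramsey_full by blast
  have SucN: "Suc ` {..<N} = {1..N}"
    by (simp add: image_Suc_lessThan)
  have "\<exists>i \<in> {1..k}. \<exists>f. is_mono_copy N \<chi> i (G i) f" if \<chi>: "\<chi> \<in> colorings k N" for \<chi>
  proof -
    have im: "(\<lambda>e. Suc ` e) \<in> nsets {..<N} 2 \<rightarrow> nsets {1..N} 2"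
      using SucN by (intro nsets_image_funcset) auto
    have \<chi>': "\<chi> e \<in> {1..k}" if "e \<in> nsets {1..N} 2" for e
      using \<chi> that by (auto simp: colorings_eq)
    \<comment> \<open>Ramsey's theorem is applied with vertices and colors numbered from 0, so both
      are shifted: list position \<open>i\<close> stands for color \<open>Suc i\<close>.\<close>
    have "(\<lambda>e. \<chi> (Suc ` e) - 1) \<in> nsets {..<N} 2 \<rightarrow> {..<k}"
      using im \<chi>' by (fastforce simp: Pi_iff)
    then obtain i K where i: "i < length ?qs" and K: "K \<in> nsets {..<N} (?qs ! i)"
      and mono: "(\<lambda>e. \<chi> (Suc ` e) - 1) ` nsets K 2 \<subseteq> {i}"
      using partn_lstE[OF N, of "\<lambda>e. \<chi> (Suc ` e) - 1" k] by auto
    have ik: "Suc i \<in> {1..k}"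
      using i by simp
    have fK: "K \<subseteq> {..<N}" "finite K" "card K = num_verts (G (Suc i))"
      using K i by (auto simp: nsets_def)
    then have SK: "Suc ` K \<subseteq> {1..N}" "card (Suc ` K) = num_verts (G (Suc i))"
      using SucN by (auto simp: card_image)
    obtain f where f: "f \<in> verts (G (Suc i)) \<rightarrow> Suc ` K" "inj_on f (verts (G (Suc i)))"
      "\<forall>(u, v) \<in> vord (G (Suc i)). f u < f v"
      using ordered_graph_order_embedding[OF G[OF ik] _ SK(2)] fK(2) by blast
    have ed: "edges (G (Suc i)) \<subseteq> nsets (verts (G (Suc i))) 2"
      and vo: "vord (G (Suc i)) \<subseteq> verts (G (Suc i)) \<times> verts (G (Suc i))"
      using G[OF ik] by (auto simp: ordered_graph_def)
    have fe: "f ` e \<in> nsets (Suc ` K) 2" if "e \<in> edges (G (Suc i))" for e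
      using nsets_image_funcset[OF f(1,2), of 2] ed that by blast
    have feN: "f ` e \<in> nsets {1..N} 2" if "e \<in> edges (G (Suc i))" for e
      using nsets_mono[OF SK(1)] fe[OF that] by blast
    have fc: "\<chi> (f ` e) = Suc i" if e: "e \<in> edges (G (Suc i))" for e
    proof -
      obtain d where d: "d \<in> nsets K 2" "f ` e = Suc ` d"
        using nset_image_obtains[OF fe[OF e]] by auto
      have "\<chi> (Suc ` d) - 1 = i"
        using mono d(1) by blast
      \<comment> \<open>Excludes color 0, which truncated subtraction would confuse with color
        1.\<close>
      moreover have "\<chi> (Suc ` d) \<ge> 1"
        using \<chi>'[OF feN[OF e]] d(2) by simp
      ultimately show ?thesis
        using d(2) by simp
    qed
    have fV: "f v \<in> {1..N}" if "v \<in> verts (G (Suc i))" for v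
      using f(1) SK(1) that by blast
    have "is_mono_copy N \<chi> (Suc i) (G (Suc i)) f"
      unfolding is_mono_copy_def is_copy_complete_iff
      using fV f(2,3) vo feN fc by (auto simp: subset_iff simp del: atLeastAtMost_iff)
    then show ?thesis
      using ik by blast
  qed
  then show thesis
    using that by blast
qed

text \<open>As \<open>k \<ge> 1\<close>, some coloring on \<open>ordered_ramsey k G\<close> vertices
  exists; the monochromatic copy it must contain injects the vertices of its graph into that many
  points.\<close>

lemma ordered_ramsey_ge_some_num_verts:
  assumes "k \<ge> 1" and G: "\<And>i. i \<in> {1..k} \<Longrightarrow> ordered_graph (G i)"
  obtains i where "i \<in> {1..k}" "num_verts (G i) \<le> ordered_ramsey k G"
proof -
  let ?R = "ordered_ramsey k G"
  obtain N where "\<forall>\<chi> \<in> colorings k N. \<exists>i \<in> {1..k}. \<exists>f. is_mono_copy N \<chi> i (G i) f"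
    using ordered_ramsey_exists[OF G] .
  then have R: "\<forall>\<chi> \<in> colorings k ?R. \<exists>i \<in> {1..k}. \<exists>f. is_mono_copy ?R \<chi> i (G i) f"
    unfolding ordered_ramsey_def by (rule LeastI)
  obtain \<chi> where "\<chi> \<in> colorings k ?R"
    using colorings_nonempty[OF assms(1)] by blast
  then obtain i f where i: "i \<in> {1..k}" and f: "is_mono_copy ?R \<chi> i (G i) f"
    using R by blast
  have "num_verts (G i) \<le> card {1..?R}"
    using f by (intro card_inj_on_le[of f]) (auto simp: is_mono_copy_def is_copy_complete_iff)
  then show thesis
    using that i by simp
qed

section \<open>Binomial quotients\<close>

text \<open>Counting pairs of an \<open>h\<close>-set inside a \<open>t\<close>-set in two ways;
  this converts the first inequality of the theorem into the second.\<close>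

lemma binomial_quotient_eq:
  assumes "h \<le> t" "t \<le> n"
  shows "real ((n - h) choose (t - h)) = real (n choose t) * (real (t choose h) / real (n choose h))"
proof -
  have "real (n choose t) * real (t choose h) = real (n choose h) * real ((n - h) choose (t - h))"
    using choose_mult[OF assms] by (metis of_nat_mult)
  moreover have "real (n choose h) > 0"
    using assms by (simp add: zero_less_binomial)
  ultimately show ?thesis
    by (simp add: field_simps)
qed

text \<open>The quotient at \<open>h\<close> is the quotient at \<open>m\<close> times
  \<open>((t - m) choose (h - m)) / ((n - m) choose (h - m))\<close>, a factor of at most 1. The
  proof clears denominators and multiplies by \<open>h choose m\<close>, which is cancelled at the
  end.\<close>

lemma binomial_quotient_antimono:
  assumes "m \<le> h" "h \<le> t" "t \<le> n"
  shows "real (t choose h) / real (n choose h) \<le> real (t choose m) / real (n choose m)"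
proof -
  have "(t choose h) * (n choose m) * (h choose m)
      = (t choose m) * (n choose m) * ((t - m) choose (h - m))"
    using choose_mult[of m h t] assms by (simp add: algebra_simps)
  also have "\<dots> \<le> (t choose m) * (n choose m) * ((n - m) choose (h - m))"
    using assms by (intro mult_left_mono binomial_right_mono) auto
  also have "\<dots> = (t choose m) * (n choose h) * (h choose m)"
    using choose_mult[of m h n] assms by (simp add: algebra_simps)
  finally have "(t choose h) * (n choose m) \<le> (t choose m) * (n choose h)"
    using assms by (simp add: zero_less_binomial)
  then have "real (t choose h) * real (n choose m) \<le> real (t choose m) * real (n choose h)"
    by (metis of_nat_le_iff of_nat_mult)
  moreover have "real (n choose h) > 0" "real (n choose m) > 0"
    using assms by (simp_all add: zero_less_binomial)
  ultimately show ?thesis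
    by (simp add: field_simps)
qed

section \<open>From the double count to the bounds on multiplicity\<close>

theorem theorem2p1:
  fixes k t n hmin :: nat
    and G :: "nat \<Rightarrow> 'a ordered_graph"
    and w :: "nat \<Rightarrow> real"
    and h :: "nat \<Rightarrow> nat"
    and J :: "nat set"
  assumes "k \<ge> 1"
    and "\<And>i. i \<in> {1..k} \<Longrightarrow> ordered_graph (G i)"
    and "\<And>i. i \<in> {1..k} \<Longrightarrow> edges (G i) \<noteq> {}"
    and "\<And>i. i \<in> {1..k} \<Longrightarrow> w i > 0"
    and h_def: "\<And>i. h i = num_verts (G i)"
    and hmin_def: "hmin = Min (h ` {1..k})"
    and "ordered_ramsey k G \<le> t" and "t \<le> n"
    and J_def: "J = {i \<in> {1..k}. h i \<le> t}"
  shows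
    "(\<forall>\<chi> \<in> colorings k n.
        (\<Sum>i\<in>J. w i * real (num_mono_copies n \<chi> i (G i)) * real ((n - h i) choose (t - h i)))
          \<ge> ordered_multiplicity k w t G * real (n choose t)
      \<and> (\<Sum>i\<in>J. w i * real (num_mono_copies n \<chi> i (G i)) * (real (t choose h i) / real (n choose h i)))
          \<ge> ordered_multiplicity k w t G)
   \<and> ordered_multiplicity k w n G
        \<ge> ordered_multiplicity k w t G * (real (n choose hmin) / real (t choose hmin))
   \<and> (\<forall>\<chi> \<in> colorings k n. \<exists>i\<in>J.
        real (num_mono_copies n \<chi> i (G i))
          \<ge> ordered_multiplicity k w t G / (real (card J) * w i)
             * (real (n choose h i) / real (t choose h i)))"
proof -
  let ?N = "\<lambda>\<chi> i. real (num_mono_copies n \<chi> i (G i))"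
  let ?q = "\<lambda>m. real (t choose m) / real (n choose m)"
  let ?M = "ordered_multiplicity k w t G"
  note w_pos = assms(4)
  have JI: "i \<in> {1..k}" "h i \<le> t" if "i \<in> J" for i
    using that by (auto simp: J_def)
  have finJ: "finite J"
    by (simp add: J_def)
  obtain j where "j \<in> {1..k}" "num_verts (G j) \<le> ordered_ramsey k G"
    using ordered_ramsey_ge_some_num_verts[OF assms(1,2)] .
  \<comment> \<open>This index yields \<open>hmin \<le> h j \<le> t\<close>, which keeps
    \<open>?q hmin\<close> positive, and makes the average over \<open>J\<close> meaningful.\<close>
  then have j: "j \<in> J"
    using assms(7) by (simp add: J_def h_def)
  have hmin: "hmin \<le> h i" if "i \<in> J" for i
    unfolding hmin_def using JI(1)[OF that] by (intro Min_le) auto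
  have first: "?M * real (n choose t)
      \<le> (\<Sum>i\<in>J. w i * ?N \<chi> i * real ((n - h i) choose (t - h i)))" if "\<chi> \<in> colorings k n" for \<chi>
    unfolding h_def
    using that w_pos by (intro ordered_multiplicity_double_count) (auto simp: J_def h_def less_imp_le)
  have second: "?M \<le> (\<Sum>i\<in>J. w i * ?N \<chi> i * ?q (h i))" if "\<chi> \<in> colorings k n" for \<chi>
  proof -
    \<comment> \<open>Every coefficient contains the factor \<open>n choose t\<close>, which is
      positive and can be divided out.\<close>
    have "(\<Sum>i\<in>J. w i * ?N \<chi> i * real ((n - h i) choose (t - h i)))
        = (\<Sum>i\<in>J. w i * ?N \<chi> i * ?q (h i)) * real (n choose t)"
      unfolding sum_distrib_right
      by (rule sum.cong) (simp_all add: binomial_quotient_eq[OF JI(2) \<open>t \<le> n\<close>])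
    moreover have "real (n choose t) > 0"
      using \<open>t \<le> n\<close> by (simp add: zero_less_binomial)
    ultimately show ?thesis
      using first[OF that] by simp
  qed
  have q_pos: "?q m > 0" if "m \<le> t" for m
    using that \<open>t \<le> n\<close> by (simp add: zero_less_binomial)
  have third: "?M * (real (n choose hmin) / real (t choose hmin)) \<le> ordered_multiplicity k w n G"
  proof -
    \<comment> \<open>A minimizing coloring, so a bound on its weighted count bounds the
      multiplicity at \<open>n\<close>.\<close>
    obtain \<chi> where \<chi>: "\<chi> \<in> colorings k n"
      and opt: "ordered_multiplicity k w n G = (\<Sum>i = 1..k. w i * ?N \<chi> i)"
      using ordered_multiplicity_attained[OF assms(1)] .
    have "?M \<le> (\<Sum>i\<in>J. w i * ?N \<chi> i * ?q (h i))"
      by (rule second[OF \<chi>])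
    \<comment> \<open>The quotient is largest at the fewest vertices, so \<open>?q hmin\<close> is a
      common upper bound that factors out.\<close>
    also have "\<dots> \<le> (\<Sum>i\<in>J. w i * ?N \<chi> i * ?q hmin)"
    proof (rule sum_mono)
      fix i assume i: "i \<in> J"
      show "w i * ?N \<chi> i * ?q (h i) \<le> w i * ?N \<chi> i * ?q hmin"
        using binomial_quotient_antimono[OF hmin[OF i] JI(2)[OF i] \<open>t \<le> n\<close>] w_pos[OF JI(1)[OF i]]
        by (intro mult_left_mono) auto
    qed
    also have "\<dots> = (\<Sum>i\<in>J. w i * ?N \<chi> i) * ?q hmin"
      by (simp only: sum_distrib_right)
    also have "\<dots> \<le> (\<Sum>i = 1..k. w i * ?N \<chi> i) * ?q hmin"
      using w_pos by (intro mult_right_mono sum_mono2) (auto simp: J_def less_imp_le)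
    finally have "?M \<le> ordered_multiplicity k w n G * ?q hmin"
      by (simp add: opt)
    then have "?M / ?q hmin \<le> ordered_multiplicity k w n G"
      using q_pos[of hmin] hmin[OF j] JI(2)[OF j] by (simp only: pos_divide_le_eq)
    then show ?thesis
      by simp
  qed
  have fourth: "\<exists>i\<in>J. ?M / (real (card J) * w i) * (real (n choose h i) / real (t choose h i)) \<le> ?N \<chi> i"
    if "\<chi> \<in> colorings k n" for \<chi>
  proof (rule ccontr)
    assume neg: "\<not> ?thesis"
    have c: "real (card J) > 0"
      using j finJ by (auto simp: card_gt_0_iff)
    \<comment> \<open>If every index failed, each summand would lie below the equal share
      \<open>?M / real (card J)\<close>; as \<open>J\<close> is nonempty, the total would be
      strictly below \<open>?M\<close>, against \<open>second\<close>.\<close>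
    have "(\<Sum>i\<in>J. w i * ?N \<chi> i * ?q (h i)) < (\<Sum>i\<in>J. ?M / real (card J))"
    proof (rule sum_strict_mono[OF finJ])
      fix i assume i: "i \<in> J"
      let ?a = "w i * ?q (h i)"
      have a: "?a > 0"
        using w_pos[OF JI(1)[OF i]] q_pos[OF JI(2)[OF i]] by (rule mult_pos_pos)
      have "?N \<chi> i < ?M / (real (card J) * w i) * (real (n choose h i) / real (t choose h i))"
        using neg i by force
      also have "\<dots> = ?M / real (card J) / ?a"
        by simp
      finally have "?N \<chi> i * ?a < ?M / real (card J)"
        using a by (simp only: pos_less_divide_eq)
      then show "w i * ?N \<chi> i * ?q (h i) < ?M / real (card J)"
        by (simp only: mult_ac)
    qed (use j in blast)
    also have "\<dots> = ?M"
      using c by simp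
    finally show False
      using second[OF that] by simp
  qed
  show ?thesis
    using first second third fourth by blast
qed

end
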